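(* Let $p$ be a prime and let $\nu$ be a positive integer. Let $A$ be a finite abelian group such that $p\nmid |A|$ and let $P$ be a finite abelian $p$-group. Let $C$ be an abelian code in $\mathbb{F}_{p^\nu}[A\times P]$, with components $C_j\subseteq \mathbb{K}_j[P]$ ($1\le j\le r_{I}$) and $D_l, D_l'\subseteq \mathbb{L}_l[P]$ ($1\le l\le r_{II}$) under the discrete Fourier transform decomposition described in the context, so that $C\cong \left(\prod_{j=1}^{r_I} C_j\right)\times\left(\prod_{l=1}^{r_{II}}(D_l\times D_l')\right)$. Then $C$ is Euclidean complementary dual if and only if both of the following hold: 1. $C_j$ is Hermitian complementary dual (meaning Euclidean complementary dual when $\mathbb{K}_j=\mathbb{F}_{p^\nu}$, i.e. $s_j=1$) for all $1\le j\le r_I$; 2. $D_l\cap (D_l')^{\perp_{\rm E}}=\{0\}$ and $D_l'\cap D_l^{\perp_{\rm E}}=\{0\}$ for all $1\le l\le r_{II}$.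
   Context: For a finite field $F$ and a finite abelian group $G$ (written additively), elements of the group algebra $F[G]$ are written $\sum_{g\in G}u_gY^g$; an abelian code in $F[G]$ is an ideal of $F[G]$. Euclidean inner product: $\langle u,v\rangle_{\rm E}=\sum_g u_gv_g$; $C^{\perp_{\rm E}}=\{v : \langle c,v\rangle_{\rm E}=0\ \forall c\in C\}$; $C$ is Euclidean complementary dual if $C\cap C^{\perp_{\rm E}}=\{0\}$. If $|F|=Q^2$ is a square, the Hermitian inner product is $\langle u,v\rangle_{\rm H}=\sum_g u_gv_g^{Q}$, $C^{\perp_{\rm H}}=\{v : \langle c,v\rangle_{\rm H}=0\ \forall c\in C\}$, and $C$ is Hermitian complementary dual if $C\cap C^{\perp_{\rm H}}=\{0\}$. For $a\in A$, the $p^\nu$-cyclotomic class of $a$ is $S_{p^\nu}(a)=\{p^{\nu i}\cdot a : i\ge 0\}$. It is of type $I$ if $S_{p^\nu}(a)=S_{p^\nu}(-a)$ and of type $II$ otherwise. Choose representatives $a_1,\dots,a_t$ of the $p^\nu$-cyclotomic classes of $A$ such that $a_1,\dots,a_{r_I}$ represent the classes of type $I$, and $a_{r_I+l},\ a_{r_I+r_{II}+l}=-a_{r_I+l}$ ($1\le l\le r_{II}$) represent the classes of type $II$; $t=r_I+2r_{II}$. Put $s_i=|S_{p^\nu}(a_i)|$, $\mathbb{K}_j=\mathbb{F}_{p^{\nu s_j}}$ for $1\le j\le r_I$ and $\mathbb{L}_l=\mathbb{F}_{p^{\nu s_{r_I+l}}}$ for $1\le l\le r_{II}$. (For $j\le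 r_I$ one has either $s_j=1$ or $s_j$ even.) Decomposition: fix an algebraic closure $\overline{\mathbb{F}}$ of $\mathbb{F}_{p^\nu}$ and a group isomorphism $a\mapsto\psi_a$ from $A$ to $\mathrm{Hom}(A,\overline{\mathbb{F}}^{\times})$. For $a\in A$ with $s=|S_{p^\nu}(a)|$ let $\Phi_a:\mathbb{F}_{p^\nu}[A\times P]\to\mathbb{F}_{p^{\nu s}}[P]$ be the ring homomorphism $\Phi_a\left(\sum_{(h,b)}\alpha_{(h,b)}Y^{(h,b)}\right)=\sum_{b\in P}\left(\sum_{h\in A}\alpha_{(h,b)}\psi_a(h)\right)Y^b$. The map $u\mapsto\left((\Phi_{a_j}(u))_{j\le r_I},(\Phi_{a_{r_I+l}}(u),\Phi_{-a_{r_I+l}}(u))_{l\le r_{II}}\right)$ is a ring isomorphism $\mathbb{F}_{p^\nu}[A\times P]\cong\left(\prod_{j=1}^{r_I}\mathbb{K}_j[P]\right)\times\left(\prod_{l=1}^{r_{II}}(\mathbb{L}_l[P]\times\mathbb{L}_l[P])\right)$. The components of an ideal $C$ are $C_j=\Phi_{a_j}(C)$, $D_l=\Phi_{a_{r_I+l}}(C)$, $D_l'=\Phi_{-a_{r_I+l}}(C)$. *)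

theory Defs
  imports
    "HOL-Algebra.Algebraic_Closure_Type"
    "HOL-Library.Poly_Mapping"
    "HOL-Library.Product_Plus"
    "HOL-Library.Cardinality"
begin

text \<open>
  For a finite abelian group, given by a type \<open>'g\<close>, and a field, given by a type \<open>'k\<close>,
  the group algebra is the type \<open>'g \<Rightarrow>\<^sub>0 'k\<close> of polynomial mappings, whose library multiplication
  is convolution; \<open>Poly_Mapping.single g c\<close> is the element $c Y^g$.
\<close>

definition abelian_code :: "('g::{finite,ab_group_add} \<Rightarrow>\<^sub>0 'k::field) set \<Rightarrow> bool" where
  "abelian_code C \<longleftrightarrow> ideal C ring_of_type_algebra"

text \<open>
  The group algebra \<open>K[G]\<close> of a subfield \<open>K\<close> of \<open>'k\<close>, inside the group algebra over \<open>'k\<close>.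
  Duals of codes over \<open>K\<close> are formed inside \<open>K[G]\<close>.
\<close>

definition group_algebra :: "'k::field set \<Rightarrow> ('g \<Rightarrow>\<^sub>0 'k) set" where
  "group_algebra K = {u. \<forall>g. Poly_Mapping.lookup u g \<in> K}"

definition euclidean_inner :: "('g::finite \<Rightarrow>\<^sub>0 'k::field) \<Rightarrow> ('g \<Rightarrow>\<^sub>0 'k) \<Rightarrow> 'k" where
  "euclidean_inner u v = (\<Sum>g\<in>UNIV. Poly_Mapping.lookup u g * Poly_Mapping.lookup v g)"

definition euclidean_dual :: "'k::field set \<Rightarrow> ('g::finite \<Rightarrow>\<^sub>0 'k) set \<Rightarrow> ('g \<Rightarrow>\<^sub>0 'k) set" where
  "euclidean_dual K C = {v \<in> group_algebra K. \<forall>c\<in>C. euclidean_inner c v = 0}"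

definition euclidean_complementary_dual ::
    "'k::field set \<Rightarrow> ('g::finite \<Rightarrow>\<^sub>0 'k) set \<Rightarrow> bool" where
  "euclidean_complementary_dual K C \<longleftrightarrow> C \<inter> euclidean_dual K C = {0}"

definition hermitian_inner :: "nat \<Rightarrow> ('g::finite \<Rightarrow>\<^sub>0 'k::field) \<Rightarrow> ('g \<Rightarrow>\<^sub>0 'k) \<Rightarrow> 'k" where
  "hermitian_inner Q u v = (\<Sum>g\<in>UNIV. Poly_Mapping.lookup u g * Poly_Mapping.lookup v g ^ Q)"

definition hermitian_dual ::
    "nat \<Rightarrow> 'k::field set \<Rightarrow> ('g::finite \<Rightarrow>\<^sub>0 'k) set \<Rightarrow> ('g \<Rightarrow>\<^sub>0 'k) set" where
  "hermitian_dual Q K C = {v \<in> group_algebra K. \<forall>c\<in>C. hermitian_inner Q c v = 0}"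

text \<open>The number \<open>Q\<close> is determined by \<open>K\<close>; over a field of non-square order the property is false.\<close>

definition hermitian_complementary_dual ::
    "'k::field set \<Rightarrow> ('g::finite \<Rightarrow>\<^sub>0 'k) set \<Rightarrow> bool" where
  "hermitian_complementary_dual K C \<longleftrightarrow>
     (\<exists>Q. card K = Q\<^sup>2 \<and> C \<inter> hermitian_dual Q K C = {0})"

definition nat_multiple :: "nat \<Rightarrow> 'a::ab_group_add \<Rightarrow> 'a" where
  "nat_multiple n a = (\<Sum>i<n. a)"

definition cyclotomic_class :: "nat \<Rightarrow> 'a::ab_group_add \<Rightarrow> 'a set" where
  "cyclotomic_class q a = {nat_multiple (q ^ i) a | i. True}"

definition type_I :: "nat \<Rightarrow> 'a::ab_group_add \<Rightarrow> bool" where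
  "type_I q a \<longleftrightarrow> cyclotomic_class q a = cyclotomic_class q (- a)"

definition type_II :: "nat \<Rightarrow> 'a::ab_group_add \<Rightarrow> bool" where
  "type_II q a \<longleftrightarrow> \<not> type_I q a"

text \<open>
  \<open>a 1, \<dots>, a (rI + 2 * rII)\<close> is a system of representatives of the \<open>q\<close>-cyclotomic classes, each
  class being represented exactly once: first the classes of type I, then one class out of each
  pair of opposite classes of type II, then the opposite classes, represented by the negatives.
\<close>

definition cyclotomic_representatives ::
    "nat \<Rightarrow> nat \<Rightarrow> nat \<Rightarrow> (nat \<Rightarrow> 'a::ab_group_add) \<Rightarrow> bool" where
  "cyclotomic_representatives q rI rII a \<longleftrightarrow>
     bij_betw (\<lambda>i. cyclotomic_class q (a i)) {1..rI + 2 * rII} (range (cyclotomic_class q)) \<and>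
     (\<forall>j\<in>{1..rI}. type_I q (a j)) \<and>
     (\<forall>l\<in>{1..rII}. type_II q (a (rI + l)) \<and> type_II q (a (rI + rII + l)) \<and>
        a (rI + rII + l) = - a (rI + l))"

text \<open>$\mathrm{Hom}(A, \overline{F}^\times)$, a group under pointwise multiplication.\<close>

definition characters :: "('a::ab_group_add \<Rightarrow> 'k::field) set" where
  "characters = {\<chi>. (\<forall>h. \<chi> h \<noteq> 0) \<and> (\<forall>g h. \<chi> (g + h) = \<chi> g * \<chi> h)}"

definition character_isomorphism :: "('a::ab_group_add \<Rightarrow> 'a \<Rightarrow> 'k::field) \<Rightarrow> bool" where
  "character_isomorphism \<psi> \<longleftrightarrow>
     bij_betw \<psi> UNIV characters \<and> (\<forall>a b. \<psi> (a + b) = (\<lambda>h. \<psi> a h * \<psi> b h))"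

text \<open>
  For a finite field \<open>'f\<close> of order \<open>q\<close>, the subfield of order $q^s$ of its algebraic closure, where
  \<open>s\<close> is the size of the \<open>q\<close>-cyclotomic class of \<open>a\<close>: the set of roots of $X^{q^s} - X$.
\<close>

definition component_field :: "nat \<Rightarrow> 'a::ab_group_add \<Rightarrow> 'f::field alg_closure set" where
  "component_field q a = {x. x ^ (q ^ card (cyclotomic_class q a)) = x}"

text \<open>The map $\Phi_a$; its values are written with coefficients in the whole algebraic closure.\<close>

definition dft_component ::
    "('a \<Rightarrow> 'a \<Rightarrow> 'f::field alg_closure) \<Rightarrow> 'a::{finite,ab_group_add} \<Rightarrow>
     ('a \<times> 'b::{finite,ab_group_add} \<Rightarrow>\<^sub>0 'f) \<Rightarrow> ('b \<Rightarrow>\<^sub>0 'f alg_closure)" where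
  "dft_component \<psi> a u =
     (\<Sum>b\<in>UNIV. Poly_Mapping.single b (\<Sum>h\<in>UNIV. to_ac (Poly_Mapping.lookup u (h, b)) * \<psi> a h))"

end

theory Submission
  imports Defs "HOL-Analysis.Cartesian_Space"
begin

text \<open>
  By Parseval, $v \in C^{\perp_{\rm E}}$ iff every $\Phi_{-a}(v)$ is orthogonal to $\Phi_a(C)$: an
  ideal is stable under the translations \<open>Y\<^sup>h\<close>, and the character matrix is invertible. Applying
  the Frobenius map to the coefficients turns $\Phi_a$ into $\Phi_{qa}$, and the indicator function
  of a cyclotomic class is the transform of an idempotent over the base field. Hence \<open>C\<close> is
  complementary dual iff, for one \<open>a\<close> in each class, no nonzero element of $\Phi_a(C)$ is orthogonal
  to $\Phi_{-a}(C)$. In type I, $-a = q^{s/2} a$ for $s > 1$, so this orthogonality is Hermitian.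
\<close>

section \<open>Frobenius powers\<close>

text \<open>The inner binomial coefficients are multiples of p, so only the two end terms of the
  expansion survive.\<close>

lemma power_prime_add:
  fixes x y :: "'k::comm_ring_1"
  assumes "prime p" "of_nat p = (0::'k)"
  shows "(x + y) ^ p = x ^ p + y ^ p"
proof -
  have p: "p > 0" using assms(1) prime_gt_0_nat by blast
  have "(x + y) ^ p = (\<Sum>k\<le>p. of_nat (p choose k) * x ^ k * y ^ (p - k))"
    by (rule binomial_ring)
  also have "\<dots> = (\<Sum>k\<in>{0,p}. of_nat (p choose k) * x ^ k * y ^ (p - k))"
  proof (rule sum.mono_neutral_right)
    show "\<forall>k\<in>{..p} - {0, p}. of_nat (p choose k) * x ^ k * y ^ (p - k) = 0"
    proof
      fix k assume "k \<in> {..p} - {0, p}"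
      then have "p dvd (p choose k)"
        using assms(1) p by (intro dvd_choose_prime) auto
      then obtain m where "p choose k = p * m" ..
      then show "of_nat (p choose k) * x ^ k * y ^ (p - k) = 0"
        by (simp add: assms(2))
    qed
  qed auto
  also have "\<dots> = x ^ p + y ^ p"
    using p by simp
  finally show ?thesis .
qed

lemma power_prime_power_add:
  fixes x y :: "'k::comm_ring_1"
  assumes "prime p" "of_nat p = (0::'k)"
  shows "(x + y) ^ (p ^ n) = x ^ (p ^ n) + y ^ (p ^ n)"
  by (induction n) (simp_all add: power_mult power_prime_add[OF assms] mult.commute[of p])

lemma power_prime_power_sum:
  fixes f :: "'i \<Rightarrow> 'k::comm_ring_1"
  assumes "prime p" "of_nat p = (0::'k)"
  shows "(\<Sum>i\<in>I. f i) ^ (p ^ n) = (\<Sum>i\<in>I. f i ^ (p ^ n))"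
proof -
  have "p ^ n > 0" using assms(1) by (simp add: prime_gt_0_nat)
  then show ?thesis
    by (induction I rule: infinite_finite_induct)
      (simp_all add: power_prime_power_add[OF assms] power_0_left)
qed

text \<open>Translation by 1 permutes the ring, so adding 1 to every summand leaves the sum of all
  elements unchanged.\<close>

lemma of_nat_card_eq_0: "of_nat CARD('f::{finite,comm_ring_1}) = (0::'f)"
proof -
  have "(\<Sum>x\<in>UNIV. x + (1::'f)) = (\<Sum>x\<in>UNIV. x)"
    by (rule sum.reindex_bij_witness[of _ "\<lambda>x. x - 1" "\<lambda>x. x + 1"]) auto
  then show ?thesis by (simp add: sum.distrib)
qed

text \<open>Multiplication by a nonzero x permutes the nonzero elements; cancelling their product
  leaves a power of x equal to 1.\<close>

lemma finite_field_power_card: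
  fixes x :: "'f::{finite,field}"
  shows "x ^ CARD('f) = x"
proof (cases "x = 0")
  case False
  have c: "CARD('f) = Suc (card (UNIV - {0::'f}))"
    using card.remove[of "UNIV :: 'f set" 0] by simp
  have "x ^ card (UNIV - {0::'f}) * (\<Prod>y\<in>UNIV-{0}. y) = (\<Prod>y\<in>UNIV-{0}. x * y)"
    by (simp add: prod.distrib)
  also have "\<dots> = (\<Prod>y\<in>UNIV-{0}. y)"
    by (rule prod.reindex_bij_witness[of _ "\<lambda>y. y / x" "\<lambda>y. x * y"]) (use False in auto)
  finally have "x ^ card (UNIV - {0::'f}) = 1" by simp
  then show ?thesis by (simp only: c power_Suc mult_1_right)
qed (simp add: power_0_left)

text \<open>X^n - X splits into linear factors, and its derivative is the constant -1 because n = 0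
  in the field, so no root is repeated. This yields the orders of the finite fields inside the
  closure.\<close>

lemma card_power_eq_self:
  fixes n :: nat
  assumes "n > 1" "of_nat n = (0::'k::alg_closed_field)"
  shows "card {x::'k. x ^ n = x} = n"
proof -
  define P :: "'k poly" where "P = monom 1 n - monom 1 1"
  have cP: "coeff P n = 1" using assms(1) by (simp add: P_def)
  have degP: "degree P = n"
  proof (rule antisym)
    show "degree P \<le> n"
      unfolding P_def using assms(1) by (intro degree_diff_le order.trans[OF degree_monom_le]) auto
    show "n \<le> degree P" by (rule le_degree) (simp add: cP)
  qed
  have P0: "P \<noteq> 0" using cP by auto
  have pP: "poly P x = x ^ n - x" for x by (simp add: P_def poly_monom)
  have dP: "pderiv P = - 1"
    using assms by (simp add: P_def pderiv_diff pderiv_monom one_pCons[symmetric] monom_0)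
  obtain A where A: "size A = n" "P = (\<Prod>x\<in>#A. [:-x, 1:])"
    using alg_closed_imp_factorization[OF P0] degP cP by auto
  have "count A x \<le> 1" for x
  proof (rule ccontr)
    assume "\<not> count A x \<le> 1"
    then have "replicate_mset 2 x \<subseteq># A"
      by (simp add: count_le_replicate_mset_subset_eq[symmetric])
    then obtain B where "A = replicate_mset 2 x + B"
      by (metis mset_subset_eq_exists_conv)
    \<comment> \<open>By the product rule, each term of the derivative keeps a factor X - x.\<close>
    then have "P = [:-x, 1:] * ([:-x, 1:] * (\<Prod>x\<in>#B. [:-x, 1:]))"
      using A(2) by (simp add: numeral_2_eq_2)
    then have "poly (pderiv P) x = 0"
      by (simp only: pderiv_mult poly_add poly_mult) simp
    then show False by (simp add: dP)
  qed
  then have cnt: "count A x = 1" if "x \<in># A" for x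
    using that by (metis count_greater_eq_one_iff le_antisym)
  have "set_mset A = {x. x ^ n = x}"
  proof -
    have "poly P x = (\<Prod>y\<in>#A. x - y)" for x
      unfolding A(2) by (induction A) (simp_all add: algebra_simps)
    then have "poly P x = 0 \<longleftrightarrow> x \<in># A" for x
      by (auto simp: prod_mset_zero_iff)
    then show ?thesis using pP by auto
  qed
  moreover have "size A = card (set_mset A)"
    by (simp add: size_multiset_overloaded_eq cnt)
  ultimately show ?thesis using A(1) by simp
qed

section \<open>Cyclotomic classes\<close>

lemma nat_multiple_0 [simp]: "nat_multiple 0 a = 0"
  and nat_multiple_Suc [simp]: "nat_multiple (Suc n) a = nat_multiple n a + a"
  by (simp_all add: nat_multiple_def)

lemma nat_multiple_zero [simp]: "nat_multiple n 0 = 0"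
  by (induction n) auto

lemma nat_multiple_add: "nat_multiple (m + n) a = nat_multiple m a + nat_multiple n a"
  by (induction n) (simp_all add: add_ac)

lemma nat_multiple_mult: "nat_multiple (m * n) a = nat_multiple m (nat_multiple n a)"
  by (induction m) (simp_all add: nat_multiple_add add_ac)

lemma nat_multiple_uminus: "nat_multiple n (- a) = - nat_multiple n a"
  by (induction n) simp_all

lemma nat_multiple_card:
  fixes a :: "'a::{finite,ab_group_add}"
  shows "nat_multiple CARD('a) a = 0"
proof -
  have "(\<Sum>x\<in>S. a) = nat_multiple (card S) a" for S :: "'a set"
    by (induction S rule: infinite_finite_induct) (simp_all add: ac_simps)
  moreover have "(\<Sum>x\<in>UNIV. x + a) = (\<Sum>x\<in>UNIV. x)"
    by (rule sum.reindex_bij_witness[of _ "\<lambda>x. x - a" "\<lambda>x. x + a"]) auto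
  ultimately show ?thesis by (simp add: sum.distrib)
qed

text \<open>Bezout provides an inverse of n modulo |A|, and |A| annihilates the group.\<close>

lemma inj_nat_multiple:
  assumes "coprime n CARD('a::{finite,ab_group_add})"
  shows "inj (nat_multiple n :: 'a \<Rightarrow> 'a)"
proof (cases "n = 0")
  \<comment> \<open>Zero is coprime to |A| only for trivial A; the Bezout identity of the other case
    needs n nonzero.\<close>
  case True
  then have "CARD('a) = 1" using assms by simp
  then show ?thesis by (metis (full_types) UNIV_I card_1_singletonE injI singletonD)
next
  case False
  then obtain x y where xy: "n * x = CARD('a) * y + 1"
    using bezout_nat[of n "CARD('a)"] assms by auto
  have "nat_multiple x (nat_multiple n a) = a" for a :: 'a
  proof -
    have "nat_multiple x (nat_multiple n a) = nat_multiple (y * CARD('a) + 1) a"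
      by (metis nat_multiple_mult xy mult.commute)
    then show ?thesis
      by (simp add: nat_multiple_mult nat_multiple_card)
  qed
  then show ?thesis by (metis injI)
qed

lemma nat_multiple_power_add:
  "nat_multiple (q ^ (i + j)) a = nat_multiple (q ^ i) (nat_multiple (q ^ j) a)"
  by (simp add: power_add nat_multiple_mult)

text \<open>Whole periods act trivially, so exponents can be reduced modulo any period d.\<close>

lemma nat_multiple_power_mod:
  assumes "nat_multiple (q ^ d) a = a"
  shows "nat_multiple (q ^ (i mod d)) a = nat_multiple (q ^ i) a"
proof -
  have "nat_multiple (q ^ (d * k)) a = a" for k
  proof (induction k)
    case (Suc k)
    have "nat_multiple (q ^ (d * Suc k)) a = nat_multiple (q ^ d) (nat_multiple (q ^ (d * k)) a)"
      by (simp only: nat_multiple_power_add[symmetric] mult_Suc_right)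
    then show ?case by (simp add: Suc assms)
  qed (simp add: nat_multiple_def)
  then have "nat_multiple (q ^ (i mod d + d * (i div d))) a = nat_multiple (q ^ (i mod d)) a"
    by (simp only: nat_multiple_power_add)
  then show ?thesis by simp
qed

lemma cyclotomic_class_self: "a \<in> cyclotomic_class q a"
  unfolding cyclotomic_class_def by (auto intro!: exI[of _ 0] simp: nat_multiple_def)

lemma nat_multiple_in_cyclotomic_class:
  "b \<in> cyclotomic_class q a \<Longrightarrow> nat_multiple q b \<in> cyclotomic_class q a"
  unfolding cyclotomic_class_def using nat_multiple_power_add[of q 1, symmetric] by (auto simp flip: power_Suc)

lemma cyclotomic_class_uminus: "cyclotomic_class q (- a) = uminus ` cyclotomic_class q a"
  by (auto simp: cyclotomic_class_def nat_multiple_uminus image_iff)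

lemma card_cyclotomic_class_uminus: "card (cyclotomic_class q (- a)) = card (cyclotomic_class q a)"
  unfolding cyclotomic_class_uminus by (rule card_image) simp

lemma card_cyclotomic_class_pos: "card (cyclotomic_class q (a::'a::{finite,ab_group_add})) > 0"
  using cyclotomic_class_self[of a q] by (auto simp: card_gt_0_iff)

text \<open>An injective self-map of a finite set is onto. It makes character sums over a class
  Frobenius invariant in \<open>class_projection\<close>.\<close>

lemma nat_multiple_image_cyclotomic_class:
  fixes a :: "'a::{finite,ab_group_add}"
  assumes "coprime q CARD('a)"
  shows "nat_multiple q ` cyclotomic_class q a = cyclotomic_class q a"
  using inj_nat_multiple[OF assms]
  by (intro endo_inj_surj) (auto intro: nat_multiple_in_cyclotomic_class inj_on_subset)

lemma card_cyclotomic_class_le: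
  assumes "d > 0" "nat_multiple (q ^ d) a = a"
  shows "card (cyclotomic_class q a) \<le> d"
proof -
  have "cyclotomic_class q a \<subseteq> (\<lambda>i. nat_multiple (q ^ i) a) ` {..<d}"
  proof
    fix x assume "x \<in> cyclotomic_class q a"
    then obtain i where "x = nat_multiple (q ^ i) a" by (auto simp: cyclotomic_class_def)
    then have "x = nat_multiple (q ^ (i mod d)) a"
      using nat_multiple_power_mod[OF assms(2)] by simp
    then show "x \<in> (\<lambda>i. nat_multiple (q ^ i) a) ` {..<d}" using assms(1) by auto
  qed
  then show ?thesis
    by (metis card_image_le card_lessThan card_mono finite_imageI finite_lessThan order_trans)
qed

text \<open>Among the s + 1 multiples with exponents 0 to s two agree, s being the class size.
  Cancelling the smaller power of q leaves a period of at most s, and no positive period is shorter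
  than s.\<close>

lemma nat_multiple_card_cyclotomic_class:
  fixes a :: "'a::{finite,ab_group_add}"
  assumes "coprime q CARD('a)"
  shows "nat_multiple (q ^ card (cyclotomic_class q a)) a = a"
proof -
  let ?s = "card (cyclotomic_class q a)"
  have "(\<lambda>i. nat_multiple (q ^ i) a) ` {..?s} \<subseteq> cyclotomic_class q a"
    by (auto simp: cyclotomic_class_def)
  then have "card ((\<lambda>i. nat_multiple (q ^ i) a) ` {..?s}) \<le> ?s"
    by (intro card_mono) auto
  then have "\<not> inj_on (\<lambda>i. nat_multiple (q ^ i) a) {..?s}"
    by (intro pigeonhole) simp
  then obtain i j where ij: "i < j" "j \<le> ?s" "nat_multiple (q ^ i) a = nat_multiple (q ^ j) a"
    unfolding inj_on_def by (metis atMost_iff linorder_neqE_nat)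
  have "nat_multiple (q ^ i) a = nat_multiple (q ^ i) (nat_multiple (q ^ (j - i)) a)"
    using ij by (metis nat_multiple_power_add le_add_diff_inverse less_imp_le)
  moreover have "inj (nat_multiple (q ^ i) :: 'a \<Rightarrow> 'a)"
    using assms by (intro inj_nat_multiple) simp
  ultimately have per: "nat_multiple (q ^ (j - i)) a = a"
    by (metis injD)
  then have "?s \<le> j - i" using ij(1) by (intro card_cyclotomic_class_le) auto
  then have "j - i = ?s" using ij by linarith
  then show ?thesis using per by simp
qed

text \<open>Here 2a = 0. For odd q this gives qa = a; for even q it gives qa = 0, hence a = 0 by
  injectivity.\<close>

lemma uminus_eq_self_imp_card_cyclotomic_class:
  fixes a :: "'a::{finite,ab_group_add}"
  assumes "coprime q CARD('a)" "- a = a"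
  shows "card (cyclotomic_class q a) = 1"
proof -
  have double: "nat_multiple (k * 2) a = 0" for k
    using assms(2) 
    by (simp only: nat_multiple_mult) (simp add: numeral_2_eq_2 neg_eq_iff_add_eq_0)
  have "nat_multiple q a = a"
  proof (cases "even q")
    case True
    then obtain k where "q = k * 2" by (metis dvd_def mult.commute)
    then have "nat_multiple q a = nat_multiple q 0" using double by simp
    then have "a = 0" using inj_nat_multiple[OF assms(1)] by (metis injD)
    then show ?thesis by simp
  next
    case False
    then obtain k where "q = k * 2 + 1" by (metis oddE mult.commute)
    then show ?thesis using double by simp
  qed
  then have "card (cyclotomic_class q a) \<le> 1"
    by (intro card_cyclotomic_class_le) auto
  then show ?thesis using card_cyclotomic_class_pos[of q a] by linarith
qed

text \<open>Negating twice makes 2i a period whenever -a = q^i a. With 0 < i < s, the only multiple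
  of s that 2i can be is s itself. The exponent i later serves as the one with Q = q^i in the
  Hermitian form.\<close>

lemma uminus_in_cyclotomic_class:
  fixes a :: "'a::{finite,ab_group_add}"
  assumes "coprime q CARD('a)" "- a \<in> cyclotomic_class q a" "card (cyclotomic_class q a) \<noteq> 1"
  obtains i where "card (cyclotomic_class q a) = 2 * i" "- a = nat_multiple (q ^ i) a"
proof -
  let ?s = "card (cyclotomic_class q a)"
  note s = nat_multiple_card_cyclotomic_class[OF assms(1), of a]
  obtain k where "- a = nat_multiple (q ^ k) a"
    using assms(2) by (auto simp: cyclotomic_class_def)
  then obtain i where i: "i < ?s" "- a = nat_multiple (q ^ i) a"
    by (metis nat_multiple_power_mod[OF s] card_cyclotomic_class_pos mod_less_divisor)
  have i0: "i > 0"
  proof (rule ccontr)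
    assume "\<not> i > 0"
    then have "- a = a" using i(2) by (simp add: nat_multiple_def)
    then show False using uminus_eq_self_imp_card_cyclotomic_class assms by blast
  qed
  have "nat_multiple (q ^ (i + i)) a = a"
    using i(2) by (metis nat_multiple_power_add nat_multiple_uminus minus_minus)
  then have per: "nat_multiple (q ^ (2 * i)) a = a" by (simp add: mult_2)
  then have le: "?s \<le> 2 * i" using i0 by (intro card_cyclotomic_class_le) auto
  \<comment> \<open>Removing one full period s shows that 2i - s is a period too; being below s, it
    must vanish.\<close>
  have "nat_multiple (q ^ (2 * i - ?s + ?s)) a = nat_multiple (q ^ (2 * i - ?s)) a"
    by (simp only: nat_multiple_power_add s)
  then have "nat_multiple (q ^ (2 * i - ?s)) a = a" using per le by simp
  then have "2 * i - ?s = 0"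
    using card_cyclotomic_class_le[of "2 * i - ?s" q a] i(1) by linarith
  then show thesis using le i(2) that[of i] by simp
qed

section \<open>The transform\<close>

abbreviation lookup :: "('g \<Rightarrow>\<^sub>0 'k::zero) \<Rightarrow> 'g \<Rightarrow> 'k" where
  "lookup \<equiv> Poly_Mapping.lookup"

text \<open>Convolution collapses to a translation for monomials, and products with monomials are
  all that the later arguments use.\<close>

lemma lookup_single_mult:
  fixes u :: "'g::{finite,ab_group_add} \<Rightarrow>\<^sub>0 'k::comm_semiring_1"
  shows "lookup (Poly_Mapping.single g k * u) x = k * lookup u (x - g)"
proof -
  have "(\<Sum>q. lookup u q when x = l + q) = lookup u (x - l)" for l
  proof -
    have "(\<Sum>q. lookup u q when x = l + q) = (\<Sum>q. lookup u q when q = x - l)"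
      by (intro Sum_any.cong arg_cong2[where f = "(when)"]) (auto simp: algebra_simps)
    then show ?thesis by simp
  qed
  then have "lookup (Poly_Mapping.single g k * u) x
      = (\<Sum>l. lookup (Poly_Mapping.single g k) l * lookup u (x - l))"
    by (simp add: lookup_mult)
  also have "\<dots> = (\<Sum>l. (k * lookup u (x - l)) when l = g)"
    by (intro Sum_any.cong) (auto simp: lookup_single when_def)
  finally show ?thesis by simp
qed

lemma abelian_code_zero: "abelian_code C \<Longrightarrow> 0 \<in> C"
  using additive_subgroup.zero_closed[OF ideal.axioms(1)]
  unfolding abelian_code_def by (fastforce simp: ring_of_type_algebra_def)

lemma abelian_code_add: "abelian_code C \<Longrightarrow> u \<in> C \<Longrightarrow> v \<in> C \<Longrightarrow> u + v \<in> C"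
  using additive_subgroup.a_closed[OF ideal.axioms(1)]
  unfolding abelian_code_def by (fastforce simp: ring_of_type_algebra_def)

lemma abelian_code_mult: "abelian_code C \<Longrightarrow> u \<in> C \<Longrightarrow> x * u \<in> C"
  using ideal.I_l_closed[of C ring_of_type_algebra u x]
  unfolding abelian_code_def by (simp add: ring_of_type_algebra_def)

lemma abelian_code_sum:
  "abelian_code C \<Longrightarrow> (\<And>i. i \<in> I \<Longrightarrow> u i \<in> C) \<Longrightarrow> (\<Sum>i\<in>I. u i) \<in> C"
  by (induction I rule: infinite_finite_induct)
    (auto intro: abelian_code_zero abelian_code_add)

lemma euclidean_inner_commute: "euclidean_inner u v = euclidean_inner v u"
  by (simp add: euclidean_inner_def mult.commute)

lemma euclidean_inner_zero_left [simp]: "euclidean_inner 0 v = 0"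
  and euclidean_inner_zero_right [simp]: "euclidean_inner u 0 = 0"
  by (simp_all add: euclidean_inner_def)

lemma lookup_dft_component:
  "lookup (dft_component \<psi> a u) b = (\<Sum>h\<in>UNIV. to_ac (lookup u (h, b)) * \<psi> a h)"
proof -
  have "lookup (dft_component \<psi> a u) b
      = (\<Sum>b'\<in>UNIV. (\<Sum>h\<in>UNIV. to_ac (lookup u (h, b')) * \<psi> a h) when b' = b)"
    by (simp add: dft_component_def lookup_sum lookup_single)
  also have "\<dots> = (\<Sum>b'\<in>UNIV. if b' = b then \<Sum>h\<in>UNIV. to_ac (lookup u (h, b')) * \<psi> a h else 0)"
    by (simp only: when_def)
  finally show ?thesis by simp
qed

lemma dft_component_zero [simp]: "dft_component \<psi> a 0 = 0"
  by (rule poly_mapping_eqI) (simp add: lookup_dft_component)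

lemma dft_component_sum: "dft_component \<psi> a (\<Sum>i\<in>I. u i) = (\<Sum>i\<in>I. dft_component \<psi> a (u i))"
proof (rule poly_mapping_eqI)
  fix b
  have "(\<Sum>h\<in>UNIV. \<Sum>i\<in>I. to_ac (lookup (u i) (h, b)) * \<psi> a h)
      = (\<Sum>i\<in>I. \<Sum>h\<in>UNIV. to_ac (lookup (u i) (h, b)) * \<psi> a h)"
    by (rule sum.swap)
  then show "lookup (dft_component \<psi> a (\<Sum>i\<in>I. u i)) b
      = lookup (\<Sum>i\<in>I. dft_component \<psi> a (u i)) b"
    by (simp add: lookup_dft_component lookup_sum to_ac_sum sum_distrib_right)
qed

section \<open>The base field of order q = p^\<nu> inside its closure\<close>

locale semisimple_dft =
  fixes p \<nu> :: nat and \<psi> :: "'a::{finite,ab_group_add} \<Rightarrow> 'a \<Rightarrow> 'f::{finite,field} alg_closure"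
  assumes prime_p: "prime p" and nu_pos: "\<nu> > 0"
    and card_field: "CARD('f) = p ^ \<nu>"
    and p_not_dvd: "\<not> p dvd CARD('a)"
    and characters: "character_isomorphism \<psi>"
begin

lemma of_nat_p: "of_nat p = (0::'f alg_closure)"
proof -
  have "of_nat (p ^ \<nu>) = (0::'f)"
    using of_nat_card_eq_0[where 'f = 'f] card_field by simp
  then have "of_nat p = (0::'f)" by simp
  then show ?thesis by (metis to_ac_0 to_ac_of_nat)
qed

lemma power_q_sum:
  fixes f :: "'i \<Rightarrow> 'f alg_closure"
  shows "(\<Sum>i\<in>I. f i) ^ ((p ^ \<nu>) ^ n) = (\<Sum>i\<in>I. f i ^ ((p ^ \<nu>) ^ n))"
  using power_prime_power_sum[OF prime_p of_nat_p, of f I "\<nu> * n"] by (simp add: power_mult)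

lemma q_gt_1: "p ^ \<nu> > 1"
  using prime_gt_1_nat[OF prime_p] nu_pos by (rule one_less_power)

lemma coprime_q: "coprime (p ^ \<nu>) CARD('a)"
  using prime_p p_not_dvd by (simp add: prime_imp_coprime)

lemma card_roots:
  assumes "n > 0"
  shows "card {x::'f alg_closure. x ^ ((p ^ \<nu>) ^ n) = x} = (p ^ \<nu>) ^ n"
proof (rule card_power_eq_self)
  show "(p ^ \<nu>) ^ n > 1" using q_gt_1 assms by (metis one_less_power)
  show "of_nat ((p ^ \<nu>) ^ n) = (0::'f alg_closure)"
    using of_nat_p nu_pos assms by simp
qed

lemma to_ac_power_q: "to_ac (x::'f) ^ ((p ^ \<nu>) ^ n) = to_ac x"
proof (induction n)
  case (Suc n)
  have "to_ac x ^ (p ^ \<nu>) = to_ac x"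
    using finite_field_power_card[of x] card_field by (simp flip: to_ac_power)
  then show ?case using Suc by (simp add: power_mult mult.commute)
qed simp

text \<open>One inclusion and equality of cardinalities. It allows elements fixed by Frobenius to be
  pulled back to the base field.\<close>

lemma range_to_ac: "range (to_ac :: 'f \<Rightarrow> 'f alg_closure) = {x. x ^ (p ^ \<nu>) = x}"
proof (rule card_seteq)
  have card: "card {x::'f alg_closure. x ^ (p ^ \<nu>) = x} = p ^ \<nu>"
    using card_roots[of 1] by simp
  show "finite {x::'f alg_closure. x ^ (p ^ \<nu>) = x}"
    by (rule card_ge_0_finite) (use card q_gt_1 in linarith)
  show "range to_ac \<subseteq> {x::'f alg_closure. x ^ (p ^ \<nu>) = x}"
    using to_ac_power_q[of _ 1] by auto
  show "card {x::'f alg_closure. x ^ (p ^ \<nu>) = x} \<le> card (range (to_ac :: 'f \<Rightarrow> _))"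
    using card card_field by (simp add: card_image inj_to_ac)
qed

lemma of_nat_card_nonzero: "of_nat CARD('a) \<noteq> (0::'f alg_closure)"
proof
  assume "of_nat CARD('a) = (0::'f alg_closure)"
  then have "CHAR('f alg_closure) dvd CARD('a)"
    by (simp only: of_nat_eq_0_iff_char_dvd)
  moreover have "CHAR('f alg_closure) dvd p"
    using of_nat_p by (simp only: of_nat_eq_0_iff_char_dvd)
  ultimately have "CHAR('f alg_closure) = 1"
    using prime_p p_not_dvd by (metis prime_nat_iff)
  then show False by (metis of_nat_1 of_nat_CHAR zero_neq_one)
qed

section \<open>Characters and their orthogonality relations\<close>

lemma psi_add_left: "\<psi> (a + b) h = \<psi> a h * \<psi> b h"
  using characters by (simp add: character_isomorphism_def)

lemma psi_character: "\<psi> a \<in> characters"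
  using characters by (auto simp: character_isomorphism_def bij_betw_def)

lemma psi_nonzero: "\<psi> a h \<noteq> 0"
  and psi_add_right: "\<psi> a (g + h) = \<psi> a g * \<psi> a h"
  using psi_character by (auto simp: characters_def)

lemma psi_zero_left [simp]: "\<psi> 0 h = 1"
  using psi_add_left[of 0 0 h] psi_nonzero[of 0 h] by simp

lemma psi_zero_right [simp]: "\<psi> a 0 = 1"
  using psi_add_right[of a 0 0] psi_nonzero[of a 0] by simp

lemma psi_uminus: "\<psi> (- a) h = \<psi> a (- h)"
proof -
  have "\<psi> a h * \<psi> (- a) h = \<psi> a h * \<psi> a (- h)"
    by (simp flip: psi_add_left psi_add_right)
  then show ?thesis using psi_nonzero by simp
qed

lemma psi_nat_multiple: "\<psi> (nat_multiple n a) h = \<psi> a h ^ n"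
  by (induction n) (simp_all add: psi_add_left mult.commute)

text \<open>A nontrivial character has a value other than 1 at some g; translating the summation by
  g multiplies the sum by that value, so the sum vanishes.\<close>

lemma sum_psi: "(\<Sum>h\<in>UNIV. \<psi> a h) = (if a = 0 then of_nat CARD('a) else 0)"
proof (cases "a = 0")
  case False
  have "inj \<psi>" using characters by (auto simp: character_isomorphism_def bij_betw_def)
  with False have "\<psi> a \<noteq> \<psi> 0" by (metis injD)
  then obtain g where g: "\<psi> a g \<noteq> 1" by fastforce
  have "\<psi> a g * (\<Sum>h\<in>UNIV. \<psi> a h) = (\<Sum>h\<in>UNIV. \<psi> a (g + h))"
    by (simp add: sum_distrib_left psi_add_right)
  also have "\<dots> = (\<Sum>h\<in>UNIV. \<psi> a h)"
    by (rule sum.reindex_bij_witness[of _ "\<lambda>h. h - g" "\<lambda>h. g + h"]) auto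
  finally have "(\<psi> a g - 1) * (\<Sum>h\<in>UNIV. \<psi> a h) = 0" by (simp add: algebra_simps)
  then show ?thesis using g False by simp
qed simp

lemma sum_psi_rows:
  "(\<Sum>h\<in>UNIV. \<psi> a h * \<psi> b (- h)) = (if a = b then of_nat CARD('a) else 0)"
  using sum_psi[of "a - b"] psi_add_left[of a "- b"] by (simp add: psi_uminus)

text \<open>The row relations give the square character table \<open>M\<close> the right inverse
  \<open>N\<close>. A right inverse of a square matrix over a field is also a left inverse, and
  reading this entrywise gives the column relations.\<close>

lemma sum_psi_columns:
  "(\<Sum>a\<in>UNIV. \<psi> a g * \<psi> a (- h)) = (if g = h then of_nat CARD('a) else 0)"
proof -
  define M :: "(('f alg_closure, 'a) vec, 'a) vec" where "M = (\<chi> a h. \<psi> a h)"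
  define N :: "(('f alg_closure, 'a) vec, 'a) vec" where "N = (\<chi> h a. \<psi> a (- h) / of_nat CARD('a))"
  have "M ** N = mat 1"
    by (simp add: M_def N_def matrix_matrix_mult_def mat_def vec_eq_iff sum_psi_rows
        of_nat_card_nonzero flip: sum_divide_distrib)
  then have "N ** M = mat 1" by (rule matrix_left_right_inverse1)
  then have "(N ** M) $ h $ g = mat 1 $ h $ g" by simp
  then have "(\<Sum>a\<in>UNIV. \<psi> a (- h) * \<psi> a g) / of_nat CARD('a) = (if h = g then 1 else 0)"
    by (simp add: M_def N_def matrix_matrix_mult_def mat_def flip: sum_divide_distrib)
  then have "(\<Sum>a\<in>UNIV. \<psi> a (- h) * \<psi> a g) = (if h = g then of_nat CARD('a) else 0)"
    using of_nat_card_nonzero by (simp split: if_splits)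
  then show ?thesis by (simp add: mult.commute eq_commute)
qed

section \<open>Frobenius, inversion and Parseval for the components\<close>

abbreviation \<Phi> :: "'a \<Rightarrow> ('a \<times> 'b::{finite,ab_group_add} \<Rightarrow>\<^sub>0 'f) \<Rightarrow> ('b \<Rightarrow>\<^sub>0 'f alg_closure)" where
  "\<Phi> \<equiv> dft_component \<psi>"

lemma dft_frobenius: "lookup (\<Phi> (nat_multiple ((p ^ \<nu>) ^ n) a) u) b = lookup (\<Phi> a u) b ^ ((p ^ \<nu>) ^ n)"
  by (simp only: lookup_dft_component power_q_sum power_mult_distrib to_ac_power_q psi_nat_multiple)

text \<open>Multiplying a by q^s returns a, so the coefficients are fixed by the power q^s.\<close>

lemma dft_in_component_field: "\<Phi> a u \<in> group_algebra (component_field (p ^ \<nu>) a)"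
  using dft_frobenius[of "card (cyclotomic_class (p ^ \<nu>) a)" a u]
  by (simp add: group_algebra_def component_field_def nat_multiple_card_cyclotomic_class[OF coprime_q])

lemma dft_inversion:
  "(\<Sum>a\<in>UNIV. lookup (\<Phi> a u) b * \<psi> a (- h)) = of_nat CARD('a) * to_ac (lookup u (h, b))"
proof -
  have "(\<Sum>a\<in>UNIV. lookup (\<Phi> a u) b * \<psi> a (- h))
      = (\<Sum>a\<in>UNIV. \<Sum>g\<in>UNIV. to_ac (lookup u (g, b)) * (\<psi> a g * \<psi> a (- h)))"
    by (simp add: lookup_dft_component sum_distrib_right mult.assoc)
  also have "\<dots> = (\<Sum>g\<in>UNIV. to_ac (lookup u (g, b)) * (\<Sum>a\<in>UNIV. \<psi> a g * \<psi> a (- h)))"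
    by (subst sum.swap) (simp add: sum_distrib_left)
  also have "\<dots> = (\<Sum>g\<in>UNIV. if g = h then to_ac (lookup u (g, b)) * of_nat CARD('a) else 0)"
    by (intro sum.cong) (simp_all add: sum_psi_columns)
  finally show ?thesis by (simp add: mult.commute)
qed

lemma dft_eq_0:
  assumes "\<And>a. \<Phi> a u = 0"
  shows "u = 0"
proof (rule poly_mapping_eqI)
  fix x :: "'a \<times> 'b"
  have "of_nat CARD('a) * to_ac (lookup u (fst x, snd x)) = 0"
    using dft_inversion[of u "snd x" "fst x"] by (simp add: assms)
  then show "lookup u x = lookup 0 x" using of_nat_card_nonzero by simp
qed

lemma parseval:
  "(\<Sum>a\<in>UNIV. euclidean_inner (\<Phi> a u) (\<Phi> (- a) v)) = of_nat CARD('a) * to_ac (euclidean_inner u v)"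
proof -
  \<comment> \<open>Only the transform of v is expanded; that of u stays intact, so that the
    inversion formula can absorb the sum over a.\<close>
  have "(\<Sum>a\<in>UNIV. euclidean_inner (\<Phi> a u) (\<Phi> (- a) v))
      = (\<Sum>a\<in>UNIV. \<Sum>b\<in>UNIV. \<Sum>h\<in>UNIV.
          to_ac (lookup v (h, b)) * (lookup (\<Phi> a u) b * \<psi> a (- h)))"
    by (simp add: euclidean_inner_def lookup_dft_component[of \<psi> "- _" v] psi_uminus
        sum_distrib_left mult_ac)
  also have "\<dots> = (\<Sum>b\<in>UNIV. \<Sum>a\<in>UNIV. \<Sum>h\<in>UNIV.
      to_ac (lookup v (h, b)) * (lookup (\<Phi> a u) b * \<psi> a (- h)))"
    by (rule sum.swap)
  also have "\<dots> = (\<Sum>b\<in>UNIV. \<Sum>h\<in>UNIV. \<Sum>a\<in>UNIV.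
      to_ac (lookup v (h, b)) * (lookup (\<Phi> a u) b * \<psi> a (- h)))"
    by (rule sum.cong[OF refl], rule sum.swap)
  also have "\<dots> = (\<Sum>b\<in>UNIV. \<Sum>h\<in>UNIV.
      of_nat CARD('a) * to_ac (lookup u (h, b) * lookup v (h, b)))"
    by (simp only: sum_distrib_left[symmetric] dft_inversion) (simp add: sum_distrib_left mult_ac)
  also have "\<dots> = (\<Sum>h\<in>UNIV. \<Sum>b\<in>UNIV.
      of_nat CARD('a) * to_ac (lookup u (h, b) * lookup v (h, b)))"
    by (rule sum.swap)
  also have "\<dots> = (\<Sum>(h, b)\<in>UNIV \<times> UNIV.
      of_nat CARD('a) * to_ac (lookup u (h, b) * lookup v (h, b)))"
    by (rule sum.cartesian_product)
  also have "\<dots> = of_nat CARD('a) * to_ac (euclidean_inner u v)"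
    by (simp add: euclidean_inner_def to_ac_sum sum_distrib_left case_prod_unfold)
  finally show ?thesis .
qed

lemma lookup_dft_single_mult:
  "lookup (\<Phi> a (Poly_Mapping.single (g, 0) k * u)) b = to_ac k * \<psi> a g * lookup (\<Phi> a u) b"
proof -
  have "lookup (\<Phi> a (Poly_Mapping.single (g, 0) k * u)) b
      = (\<Sum>h\<in>UNIV. to_ac k * to_ac (lookup u (h - g, b)) * \<psi> a h)"
    by (simp add: lookup_dft_component lookup_single_mult)
  also have "\<dots> = (\<Sum>h\<in>UNIV. to_ac k * to_ac (lookup u (h, b)) * \<psi> a (g + h))"
    by (rule sum.reindex_bij_witness[of _ "\<lambda>h. g + h" "\<lambda>h. h - g"]) auto
  finally show ?thesis
    by (simp add: lookup_dft_component psi_add_right sum_distrib_left mult_ac)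
qed

lemma euclidean_dual_iff:
  assumes "abelian_code C"
  shows "v \<in> euclidean_dual UNIV C \<longleftrightarrow> (\<forall>a. \<forall>c\<in>C. euclidean_inner (\<Phi> a c) (\<Phi> (- a) v) = 0)"
proof
  assume v: "v \<in> euclidean_dual UNIV C"
  show "\<forall>a. \<forall>c\<in>C. euclidean_inner (\<Phi> a c) (\<Phi> (- a) v) = 0"
  proof (intro allI ballI)
    fix a c assume c: "c \<in> C"
    \<comment> \<open>\<open>T b\<close> is the term of index b in the Parseval sum for c and
      v.\<close>
    define T where "T b = euclidean_inner (\<Phi> b c) (\<Phi> (- b) v)" for b
    have T: "(\<Sum>b\<in>UNIV. \<psi> b h * T b) = 0" for h
    proof -
      \<comment> \<open>The translate by h stays in the ideal, and its Parseval terms are those of c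
        weighted by \<open>\<psi> b h\<close>.\<close>
      let ?x = "Poly_Mapping.single (h, 0) 1 * c"
      have "?x \<in> C" using assms c by (rule abelian_code_mult)
      then have "(\<Sum>b\<in>UNIV. euclidean_inner (\<Phi> b ?x) (\<Phi> (- b) v)) = 0"
        using v by (simp add: parseval euclidean_dual_def)
      moreover have "euclidean_inner (\<Phi> b ?x) (\<Phi> (- b) v) = \<psi> b h * T b" for b
        by (simp add: euclidean_inner_def T_def lookup_dft_single_mult sum_distrib_left mult.assoc)
      ultimately show ?thesis by simp
    qed
    \<comment> \<open>Row orthogonality solves the linear system \<open>T\<close> and isolates a
      single term.\<close>
    have "of_nat CARD('a) * T a = (\<Sum>b\<in>UNIV. if b = a then of_nat CARD('a) * T b else 0)"
      by simp
    also have "\<dots> = (\<Sum>b\<in>UNIV. (\<Sum>h\<in>UNIV. \<psi> b h * \<psi> a (- h)) * T b)"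
      by (intro sum.cong) (simp_all add: sum_psi_rows)
    also have "\<dots> = (\<Sum>b\<in>UNIV. \<Sum>h\<in>UNIV. \<psi> a (- h) * (\<psi> b h * T b))"
      by (simp add: sum_distrib_left sum_distrib_right mult_ac)
    also have "\<dots> = (\<Sum>h\<in>UNIV. \<Sum>b\<in>UNIV. \<psi> a (- h) * (\<psi> b h * T b))"
      by (rule sum.swap)
    also have "\<dots> = 0" by (simp add: T flip: sum_distrib_left)
    finally show "euclidean_inner (\<Phi> a c) (\<Phi> (- a) v) = 0"
      using of_nat_card_nonzero by (simp add: T_def)
  qed
next
  assume *: "\<forall>a. \<forall>c\<in>C. euclidean_inner (\<Phi> a c) (\<Phi> (- a) v) = 0"
  have "euclidean_inner c v = 0" if "c \<in> C" for c
    using parseval[of c v] * that of_nat_card_nonzero by simp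
  then show "v \<in> euclidean_dual UNIV C"
    by (simp add: euclidean_dual_def group_algebra_def)
qed

text \<open>Multiplying c by the idempotent of the class keeps it in the ideal. The work is to see
  that this idempotent has coefficients in the base field.\<close>

lemma class_projection:
  assumes "abelian_code C" "c \<in> C"
  obtains v where "v \<in> C"
    "\<And>b. \<Phi> b v = (if b \<in> cyclotomic_class (p ^ \<nu>) a then \<Phi> b c else 0)"
proof -
  define S where "S = cyclotomic_class (p ^ \<nu>) a"
  \<comment> \<open>The inverse transform of the indicator function of \<open>S\<close>; Frobenius
    only permutes its summands.\<close>
  define \<epsilon> where "\<epsilon> h = (\<Sum>x\<in>S. \<psi> x (- h)) / of_nat CARD('a)" for h
  have "\<epsilon> h \<in> range to_ac" for h
  proof -
    have "(\<Sum>x\<in>S. \<psi> x (- h)) ^ (p ^ \<nu>) = (\<Sum>x\<in>S. \<psi> (nat_multiple (p ^ \<nu>) x) (- h))"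
      using power_q_sum[of "\<lambda>x. \<psi> x (- h)" S 1] by (simp add: psi_nat_multiple)
    also have "\<dots> = (\<Sum>x\<in>nat_multiple (p ^ \<nu>) ` S. \<psi> x (- h))"
      using inj_nat_multiple[OF coprime_q]
      by (subst sum.reindex) (auto intro: inj_on_subset)
    also have "nat_multiple (p ^ \<nu>) ` S = S"
      unfolding S_def by (rule nat_multiple_image_cyclotomic_class[OF coprime_q])
    finally have "(\<Sum>x\<in>S. \<psi> x (- h)) ^ (p ^ \<nu>) = (\<Sum>x\<in>S. \<psi> x (- h))" .
    \<comment> \<open>The denominator |A| comes from the base field, so Frobenius fixes it.\<close>
    moreover have "of_nat CARD('a) ^ (p ^ \<nu>) = (of_nat CARD('a) :: 'f alg_closure)"
      using to_ac_power_q[of "of_nat CARD('a)" 1] by simp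
    ultimately show ?thesis
      by (simp add: range_to_ac \<epsilon>_def power_divide)
  qed
  then have e: "to_ac (of_ac (\<epsilon> h)) = \<epsilon> h" for h
    by (rule to_ac_of_ac)
  define v where "v = (\<Sum>h\<in>UNIV. Poly_Mapping.single (h, 0) (of_ac (\<epsilon> h)) * c)"
  show thesis
  proof (rule that)
    show "v \<in> C"
      unfolding v_def using assms by (intro abelian_code_sum abelian_code_mult)
    fix b
    have "(\<Sum>h\<in>UNIV. \<epsilon> h * \<psi> b h) = (\<Sum>h\<in>UNIV. \<Sum>x\<in>S. \<psi> b h * \<psi> x (- h)) / of_nat CARD('a)"
      by (simp add: \<epsilon>_def sum_distrib_left sum_distrib_right sum_divide_distrib mult.commute)
    also have "\<dots> = (\<Sum>x\<in>S. \<Sum>h\<in>UNIV. \<psi> b h * \<psi> x (- h)) / of_nat CARD('a)"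
      by (subst sum.swap) simp
    also have "\<dots> = (if b \<in> S then 1 else 0)"
      using of_nat_card_nonzero by (simp add: sum_psi_rows S_def)
    finally have \<epsilon>: "(\<Sum>h\<in>UNIV. \<epsilon> h * \<psi> b h) = (if b \<in> S then 1 else 0)" .
    show "\<Phi> b v = (if b \<in> cyclotomic_class (p ^ \<nu>) a then \<Phi> b c else 0)"
    proof (rule poly_mapping_eqI)
      fix y
      have "lookup (\<Phi> b v) y = (\<Sum>h\<in>UNIV. \<epsilon> h * \<psi> b h) * lookup (\<Phi> b c) y"
        by (simp add: v_def dft_component_sum lookup_sum lookup_dft_single_mult e sum_distrib_right)
      then show "lookup (\<Phi> b v) y
          = lookup (if b \<in> cyclotomic_class (p ^ \<nu>) a then \<Phi> b c else 0) y"
        by (simp add: \<epsilon> S_def)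
    qed
  qed
qed

section \<open>Complementary duality of the components\<close>

text \<open>One-sided nondegeneracy of the pairing between the components at -a and a; the other
  side is the same condition at -a. Quantifying over codewords, not component vectors, lets one
  codeword be followed through all components.\<close>

definition component_nondegenerate ::
    "('a \<times> 'b::{finite,ab_group_add} \<Rightarrow>\<^sub>0 'f) set \<Rightarrow> 'a \<Rightarrow> bool" where
  "component_nondegenerate C a \<longleftrightarrow>
     (\<forall>c\<in>C. (\<forall>c'\<in>C. euclidean_inner (\<Phi> (- a) c') (\<Phi> a c) = 0) \<longrightarrow> \<Phi> a c = 0)"

lemma dft_inner_frobenius:
  "euclidean_inner (\<Phi> (- nat_multiple ((p ^ \<nu>) ^ n) a) u) (\<Phi> (nat_multiple ((p ^ \<nu>) ^ n) a) v)
    = euclidean_inner (\<Phi> (- a) u) (\<Phi> a v) ^ ((p ^ \<nu>) ^ n)"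
  unfolding euclidean_inner_def nat_multiple_uminus[symmetric] dft_frobenius
  by (simp only: power_q_sum power_mult_distrib)

lemma dft_frobenius_eq_0_iff: "\<Phi> (nat_multiple ((p ^ \<nu>) ^ n) a) u = 0 \<longleftrightarrow> \<Phi> a u = 0"
proof -
  have "(p ^ \<nu>) ^ n > 0" using prime_gt_0_nat[OF prime_p] by simp
  then show ?thesis by (simp add: poly_mapping_eq_iff fun_eq_iff dft_frobenius)
qed

text \<open>Moving along the class raises pairings and coefficients to a power of q, and in a field
  a positive power vanishes only with its base.\<close>

lemma component_nondegenerate_class:
  assumes "component_nondegenerate C a" "b \<in> cyclotomic_class (p ^ \<nu>) a"
  shows "component_nondegenerate C b"
proof -
  obtain n where n: "b = nat_multiple ((p ^ \<nu>) ^ n) a"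
    using assms(2) by (auto simp: cyclotomic_class_def)
  show ?thesis
    using assms(1) q_gt_1
    by (simp add: component_nondegenerate_def n dft_inner_frobenius dft_frobenius_eq_0_iff)
qed

text \<open>A codeword violating nondegeneracy at a is cut down to the class of a. The result is
  orthogonal to C at every index, by Frobenius on the class and by vanishing off it, so it lies in
  the code and its dual.\<close>

lemma euclidean_complementary_dual_iff:
  assumes C: "abelian_code C"
  shows "euclidean_complementary_dual UNIV C \<longleftrightarrow> (\<forall>a. component_nondegenerate C a)"
proof
  assume lcd: "euclidean_complementary_dual UNIV C"
  show "\<forall>a. component_nondegenerate C a"
    unfolding component_nondegenerate_def
  proof (intro allI ballI impI)
    fix a c assume c: "c \<in> C" and orth: "\<forall>c'\<in>C. euclidean_inner (\<Phi> (- a) c') (\<Phi> a c) = 0"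
    obtain v where v: "v \<in> C"
      "\<And>b. \<Phi> b v = (if b \<in> cyclotomic_class (p ^ \<nu>) a then \<Phi> b c else 0)"
      using class_projection[OF C c, of a] by blast
    have "euclidean_inner (\<Phi> b c') (\<Phi> (- b) v) = 0" if "c' \<in> C" for b c'
    \<comment> \<open>The case split is on -b because Parseval pairs the component of c' at b with
      that of v at -b.\<close>
    proof (cases "- b \<in> cyclotomic_class (p ^ \<nu>) a")
      case True
      then obtain n where n: "- b = nat_multiple ((p ^ \<nu>) ^ n) a"
        by (auto simp: cyclotomic_class_def)
      have "euclidean_inner (\<Phi> (- (- b)) c') (\<Phi> (- b) c) = 0"
        unfolding n dft_inner_frobenius using orth that prime_gt_0_nat[OF prime_p] by simp
      then show ?thesis using True by (simp add: v(2))
    qed (simp add: v(2))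
    then have "v \<in> euclidean_dual UNIV C"
      by (simp add: euclidean_dual_iff[OF C])
    then have "v = 0" using lcd v(1) by (auto simp: euclidean_complementary_dual_def)
    then show "\<Phi> a c = 0" using v(2)[of a] cyclotomic_class_self[of a] by simp
  qed
next
  assume nd: "\<forall>a. component_nondegenerate C a"
  have "v = 0" if v: "v \<in> C" "v \<in> euclidean_dual UNIV C" for v
  proof (rule dft_eq_0)
    fix a
    have "euclidean_inner (\<Phi> (- a) c) (\<Phi> (- (- a)) v) = 0" if "c \<in> C" for c
      using v(2) that unfolding euclidean_dual_iff[OF C] by blast
    then show "\<Phi> a v = 0" using nd v(1) by (auto simp: component_nondegenerate_def)
  qed
  moreover have "0 \<in> euclidean_dual UNIV C"
    by (simp add: euclidean_dual_iff[OF C])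
  ultimately show "euclidean_complementary_dual UNIV C"
    using abelian_code_zero[OF C] by (auto simp: euclidean_complementary_dual_def)
qed

text \<open>Components of codewords already have coefficients in the component field, so
  intersecting with the dual imposes orthogonality only.\<close>

lemma dft_inter_euclidean_dual_iff:
  assumes C: "abelian_code C"
  shows "\<Phi> a ` C \<inter> euclidean_dual (component_field (p ^ \<nu>) a) (\<Phi> (- a) ` C) = {0}
    \<longleftrightarrow> component_nondegenerate C a"
proof -
  have zero: "0 \<in> \<Phi> a ` C"
    using abelian_code_zero[OF C] dft_component_zero by (metis imageI)
  have "euclidean_dual (component_field (p ^ \<nu>) a) (\<Phi> (- a) ` C) \<inter> \<Phi> a ` C
      = {w \<in> \<Phi> a ` C. \<forall>c'\<in>C. euclidean_inner (\<Phi> (- a) c') w = 0}"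
    using dft_in_component_field by (auto simp: euclidean_dual_def)
  then show ?thesis
    unfolding component_nondegenerate_def using zero by (auto simp: Int_commute)
qed

text \<open>Since -a = q^i a, raising coefficients to the power Q = q^i turns the component at a
  into the one at -a, so the Hermitian form becomes the pairing between these two.\<close>

lemma hermitian_complementary_dual_iff:
  assumes C: "abelian_code C" and a: "- a \<in> cyclotomic_class (p ^ \<nu>) a"
    "card (cyclotomic_class (p ^ \<nu>) a) \<noteq> 1"
  shows "hermitian_complementary_dual (component_field (p ^ \<nu>) a) (\<Phi> a ` C)
    \<longleftrightarrow> component_nondegenerate C a"
proof -
  let ?K = "component_field (p ^ \<nu>) a :: 'f alg_closure set"
  obtain i where i: "card (cyclotomic_class (p ^ \<nu>) a) = 2 * i" "- a = nat_multiple ((p ^ \<nu>) ^ i) a"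
    using uminus_in_cyclotomic_class[OF coprime_q a] .
  have "card ?K = (p ^ \<nu>) ^ (2 * i)"
    unfolding component_field_def i(1)
    by (rule card_roots) (use i(1) card_cyclotomic_class_pos[of "p ^ \<nu>" a] in simp)
  then have "card ?K = ((p ^ \<nu>) ^ i)\<^sup>2"
    by (metis power_mult mult.commute)
  \<comment> \<open>The order of the field determines Q, so the existential in the Hermitian
    condition has one possible witness.\<close>
  then have Q: "card ?K = Q\<^sup>2 \<longleftrightarrow> Q = (p ^ \<nu>) ^ i" for Q
    using power2_eq_iff_nonneg[of Q "(p ^ \<nu>) ^ i"] by auto
  have inner: "hermitian_inner ((p ^ \<nu>) ^ i) (\<Phi> a c') (\<Phi> a c)
      = euclidean_inner (\<Phi> (- a) c) (\<Phi> a c')" for c c'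
    by (simp add: hermitian_inner_def euclidean_inner_def i(2) dft_frobenius mult.commute)
  \<comment> \<open>Hermitian symmetry: the power q^i interchanges a and -a, hence the roles of c
    and c', without affecting vanishing.\<close>
  have inner_swap: "euclidean_inner (\<Phi> (- a) c) (\<Phi> a c') = 0
      \<longleftrightarrow> euclidean_inner (\<Phi> (- a) c') (\<Phi> a c) = 0" for c c'
  proof -
    have "euclidean_inner (\<Phi> (- (- a)) c') (\<Phi> (- a) c)
        = euclidean_inner (\<Phi> (- a) c') (\<Phi> a c) ^ ((p ^ \<nu>) ^ i)"
      using dft_inner_frobenius[of i a c' c] by (simp only: i(2)[symmetric])
    then show ?thesis
      using prime_gt_0_nat[OF prime_p] by (simp add: euclidean_inner_commute[of "\<Phi> (- a) c"])
  qed
  have zero: "0 \<in> \<Phi> a ` C"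
    using abelian_code_zero[OF C] dft_component_zero by (metis imageI)
  have "\<Phi> a ` C \<inter> hermitian_dual ((p ^ \<nu>) ^ i) ?K (\<Phi> a ` C)
      = {w \<in> \<Phi> a ` C. \<forall>c'\<in>C. euclidean_inner (\<Phi> (- a) c') w = 0}"
    using dft_in_component_field by (auto simp: hermitian_dual_def inner inner_swap)
  moreover have "hermitian_complementary_dual ?K (\<Phi> a ` C)
      \<longleftrightarrow> \<Phi> a ` C \<inter> hermitian_dual ((p ^ \<nu>) ^ i) ?K (\<Phi> a ` C) = {0}"
    by (simp add: hermitian_complementary_dual_def Q)
  ultimately show ?thesis
    unfolding component_nondegenerate_def using zero by auto
qed

lemma component_field_uminus: "component_field (p ^ \<nu>) (- a) = component_field (p ^ \<nu>) a"
  by (simp add: component_field_def card_cyclotomic_class_uminus)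

text \<open>Every b shares its class with some representative, and nondegeneracy is constant on
  classes.\<close>

lemma all_component_nondegenerate_iff:
  assumes "cyclotomic_representatives (p ^ \<nu>) rI rII a"
  shows "(\<forall>b. component_nondegenerate C b) \<longleftrightarrow>
    (\<forall>j\<in>{1..rI}. component_nondegenerate C (a j)) \<and>
    (\<forall>l\<in>{1..rII}. component_nondegenerate C (a (rI + l)) \<and> component_nondegenerate C (- a (rI + l)))"
    (is "_ \<longleftrightarrow> ?R")
proof (intro iffI allI)
  fix b assume R: "?R"
  have "cyclotomic_class (p ^ \<nu>) b
      \<in> (\<lambda>i. cyclotomic_class (p ^ \<nu>) (a i)) ` {1..rI + 2 * rII}"
    using assms by (simp add: cyclotomic_representatives_def bij_betw_def)
  then obtain i where i: "i \<in> {1..rI + 2 * rII}"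
    "cyclotomic_class (p ^ \<nu>) b = cyclotomic_class (p ^ \<nu>) (a i)" by auto
  have "component_nondegenerate C (a i)"
  proof -
    \<comment> \<open>The indices form three consecutive blocks; the third consists of the negatives
      of the second.\<close>
    consider "i \<in> {1..rI}" | l where "l \<in> {1..rII}" "i = rI + l"
      | l where "l \<in> {1..rII}" "i = rI + rII + l"
    proof -
      have "i \<in> {1..rI} \<or> (i - rI \<in> {1..rII} \<and> i = rI + (i - rI))
          \<or> (i - (rI + rII) \<in> {1..rII} \<and> i = rI + rII + (i - (rI + rII)))"
        using i(1) by auto
      then show thesis using that by blast
    qed
    then show ?thesis
    proof cases
      case (3 l)
      then have "a i = - a (rI + l)"
        using assms by (simp add: cyclotomic_representatives_def)
      then show ?thesis using R 3 by auto
    qed (use R in auto)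
  qed
  then show "component_nondegenerate C b"
    using component_nondegenerate_class cyclotomic_class_self i(2) by metis
qed auto

end

section \<open>The criterion read off at the class representatives\<close>

theorem proposition4p1:
  fixes p \<nu> rI rII :: nat
    and C :: "('a::{finite,ab_group_add} \<times> 'b::{finite,ab_group_add} \<Rightarrow>\<^sub>0 'f::{finite,field}) set"
    and a :: "nat \<Rightarrow> 'a"
    and \<psi> :: "'a \<Rightarrow> 'a \<Rightarrow> 'f alg_closure"
  assumes "prime p" and "\<nu> > 0"
    and "CARD('f) = p ^ \<nu>"
    and "\<not> p dvd CARD('a)"
    and "\<exists>m. CARD('b) = p ^ m"
    and "abelian_code C"
    and "cyclotomic_representatives (p ^ \<nu>) rI rII a"
    and "character_isomorphism \<psi>"
  shows "euclidean_complementary_dual UNIV C \<longleftrightarrow>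
    (\<forall>j\<in>{1..rI}.
       let K = component_field (p ^ \<nu>) (a j);
           Cj = dft_component \<psi> (a j) ` C
       in if card (cyclotomic_class (p ^ \<nu>) (a j)) = 1
          then euclidean_complementary_dual K Cj
          else hermitian_complementary_dual K Cj) \<and>
    (\<forall>l\<in>{1..rII}.
       let L = component_field (p ^ \<nu>) (a (rI + l));
           D = dft_component \<psi> (a (rI + l)) ` C;
           D' = dft_component \<psi> (- a (rI + l)) ` C
       in D \<inter> euclidean_dual L D' = {0} \<and> D' \<inter> euclidean_dual L D = {0})"
proof -
  interpret semisimple_dft p \<nu> \<psi>
    using assms by unfold_locales
  note C = \<open>abelian_code C\<close>
  have typeI: "(if card (cyclotomic_class (p ^ \<nu>) x) = 1
          then euclidean_complementary_dual (component_field (p ^ \<nu>) x) (\<Phi> x ` C)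
          else hermitian_complementary_dual (component_field (p ^ \<nu>) x) (\<Phi> x ` C))
      \<longleftrightarrow> component_nondegenerate C x" if "type_I (p ^ \<nu>) x" for x
  proof -
    have mem: "- x \<in> cyclotomic_class (p ^ \<nu>) x"
      using that cyclotomic_class_self[of "- x"] by (simp add: type_I_def)
    show ?thesis
    proof (cases "card (cyclotomic_class (p ^ \<nu>) x) = 1")
      case True
      \<comment> \<open>A one-element class contains both x and -x, so the pairing of the components
        at -x and x is the Euclidean form on a single component.\<close>
      then have "- x = x"
        using mem cyclotomic_class_self[of x] by (metis card_1_singletonE singletonD)
      then show ?thesis
        using dft_inter_euclidean_dual_iff[OF C, of x] True
        by (simp only: euclidean_complementary_dual_def refl if_True)
    next
      case False
      then show ?thesis
        using hermitian_complementary_dual_iff[OF C mem False] by (simp only: if_False)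
    qed
  qed
  \<comment> \<open>The second type II condition is the first with x replaced by -x; opposite
    classes have equal size, so both duals are taken over one field.\<close>
  have typeII: "\<Phi> (- x) ` C \<inter> euclidean_dual (component_field (p ^ \<nu>) x) (\<Phi> x ` C) = {0}
      \<longleftrightarrow> component_nondegenerate C (- x)" for x
    using dft_inter_euclidean_dual_iff[OF C, of "- x"] by (simp add: component_field_uminus)
  have "type_I (p ^ \<nu>) (a j)" if "j \<in> {1..rI}" for j
    using assms(7) that by (simp add: cyclotomic_representatives_def)
  then show ?thesis
    unfolding Let_def euclidean_complementary_dual_iff[OF C] typeII
      all_component_nondegenerate_iff[OF assms(7)] dft_inter_euclidean_dual_iff[OF C]
    by (simp only: typeI cong: ball_cong)
qed

end
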